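(* For any finite poset $(P,\preceq)$, \[\overline{\mathcal{O}}(P,\preceq,\preceq)^{\triangle}=\operatorname{conv}\big((-\mathrm{Val}_0(P))\times\{1\}\ \cup\ \mathrm{Val}_0(P)\times\{-1\}\big).\]
   Context: For a poset $Q$, $\mathcal{O}(Q)=\{f:Q\to\mathbb{R}:0\le f(a)\le f(b)\le1\text{ for }a\preceq b\}$. For the double poset $(P,\preceq,\preceq)$ (both orders equal), $\overline{\mathcal{O}}(P,\preceq,\preceq)=\operatorname{conv}\big((2\mathcal{O}(P)\times\{1\})\cup(-2\mathcal{O}(P)\times\{-1\})\big)\subset\mathbb{R}^P\times\mathbb{R}$. The polar of $S\subseteq\mathbb{R}^m$ is $S^\triangle=\{\ell\in(\mathbb{R}^m)^*:\ell(s)\le1\text{ for all }s\in S\}$, where $(\mathbb{R}^P\times\mathbb{R})^*$ is identified with $\mathbb{R}^P\times\mathbb{R}$ via the standard pairing. A filter is an up-closed subset. $\mathrm{Val}_0(P)=\{h:P\to\mathbb{R}: 0\le\sum_{a\in\Phi}h(a)\le1\text{ for all filters }\Phi\subseteq P\}$ (the valuation polytope of the filter lattice of $P$ in coordinates). The right-hand side is the twisted prism of $-\mathrm{Val}_0(P)$. *)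

theory Defs
  imports "HOL-Analysis.Analysis"
begin

text \<open>
  A finite poset is a carrier \<open>P\<close> inside a finite type \<open>'a\<close>, with an order relation
  satisfying \<open>partial_order_on P r\<close>; \<open>P\<close> may be empty or a proper subset of the type.
  A function \<open>P \<rightarrow> \<real>\<close> is encoded as a vector of \<open>real ^ 'a\<close> that vanishes off \<open>P\<close>.
\<close>

definition funs_on :: "'a::finite set \<Rightarrow> (real ^ 'a) set"
  where "funs_on P = {f. \<forall>a. a \<notin> P \<longrightarrow> f $ a = 0}"

definition order_polytope :: "'a::finite set \<Rightarrow> 'a rel \<Rightarrow> (real ^ 'a) set"
  where "order_polytope P r =
    {f \<in> funs_on P. \<forall>a\<in>P. \<forall>b\<in>P. (a, b) \<in> r \<longrightarrow> 0 \<le> f $ a \<and> f $ a \<le> f $ b \<and> f $ b \<le> 1}"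

definition double_order_polytope ::
    "'a::finite set \<Rightarrow> 'a rel \<Rightarrow> 'a rel \<Rightarrow> ((real ^ 'a) \<times> real) set"
  where "double_order_polytope P r s =
    convex hull
      ((\<lambda>f. 2 *\<^sub>R f) ` order_polytope P r \<times> {1} \<union>
       (\<lambda>f. (- 2) *\<^sub>R f) ` order_polytope P s \<times> {- 1})"

text \<open>
  The polar of a subset \<open>S\<close> of the coordinate subspace \<open>V\<close>: the dual space of \<open>V\<close> is identified
  with \<open>V\<close> itself via the standard inner product.
\<close>

definition polar_in :: "'v::real_inner set \<Rightarrow> 'v set \<Rightarrow> 'v set"
  where "polar_in V S = {l \<in> V. \<forall>s\<in>S. l \<bullet> s \<le> 1}"

definition poset_filter :: "'a set \<Rightarrow> 'a rel \<Rightarrow> 'a set \<Rightarrow> bool"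
  where "poset_filter P r \<Phi> \<longleftrightarrow> \<Phi> \<subseteq> P \<and> (\<forall>a\<in>\<Phi>. \<forall>b\<in>P. (a, b) \<in> r \<longrightarrow> b \<in> \<Phi>)"

definition Val0 :: "'a::finite set \<Rightarrow> 'a rel \<Rightarrow> (real ^ 'a) set"
  where "Val0 P r =
    {h \<in> funs_on P. \<forall>\<Phi>. poset_filter P r \<Phi> \<longrightarrow> 0 \<le> (\<Sum>a\<in>\<Phi>. h $ a) \<and> (\<Sum>a\<in>\<Phi>. h $ a) \<le> 1}"

end

theory Submission
  imports Defs
begin

text \<open>
  Pairing a valuation with the layer-cake decomposition of a monotone function into filter
  indicators gives one inclusion. For the other, separate a point of the polar from the right-hand
  side by a functional \<open>(x, s)\<close>. Put \<open>f a = sup x \<bullet> h\<close> and \<open>g a = sup (- x) \<bullet> h\<close> over the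
  \<open>h \<in> Val0\<close> supported below \<open>a\<close>. These are monotone, and \<open>f - g = x\<close> because \<open>h \<mapsto> e\<^sub>a - h\<close> is an
  involution of that set. Moreover \<open>f\<close> and \<open>g\<close> are bounded by the support function of \<open>Val0\<close> at
  \<open>x\<close> and \<open>- x\<close>; testing the point of the polar on multiples of \<open>f\<close> and \<open>g\<close> contradicts
  separation.
\<close>

section \<open>Pairing valuations with monotone functions\<close>

lemma inner_vec_eq_sum_on:
  fixes h f :: "real ^ 'a::finite"
  assumes "h \<in> funs_on P"
  shows "h \<bullet> f = (\<Sum>a\<in>P. h $ a * f $ a)"
proof -
  have "h \<bullet> f = (\<Sum>a\<in>UNIV. h $ a * f $ a)"
    by (simp add: inner_vec_def)
  also have "\<dots> = (\<Sum>a\<in>P. h $ a * f $ a)"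
    using assms by (intro sum.mono_neutral_right) (auto simp: funs_on_def)
  finally show ?thesis .
qed

text \<open>Peel off one layer at a time: subtract the least positive value \<open>m\<close> on the
  filter where \<open>f\<close> is positive. The point attaining \<open>m\<close> leaves that
  filter, the upper bound drops to \<open>c - m\<close>, and the removed layer contributes
  \<open>m\<close> times a filter sum, a number between 0 and \<open>m\<close>.\<close>

lemma monotone_pairing_bounds:
  fixes h :: "real ^ 'a::finite" and f :: "'a \<Rightarrow> real"
  assumes h: "h \<in> Val0 P r"
    and "\<And>a. a \<in> P \<Longrightarrow> 0 \<le> f a" and "\<And>a. a \<in> P \<Longrightarrow> f a \<le> c" and "0 \<le> c"
    and "\<And>a b. a \<in> P \<Longrightarrow> b \<in> P \<Longrightarrow> (a, b) \<in> r \<Longrightarrow> f a \<le> f b"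
  shows "0 \<le> (\<Sum>a\<in>P. h $ a * f a) \<and> (\<Sum>a\<in>P. h $ a * f a) \<le> c"
  using assms(2-)
proof (induction "card {a \<in> P. 0 < f a}" arbitrary: f c rule: less_induct)
  case less
  let ?F = "{a \<in> P. 0 < f a}"
  show ?case
  proof (cases "?F = {}")
    case True
    then have "f a = 0" if "a \<in> P" for a
      using less.prems(1)[OF that] that by force
    then show ?thesis using less.prems(3) by simp
  next
    case False
    define m where "m = Min (f ` ?F)"
    have "m \<in> f ` ?F" unfolding m_def using False by (intro Min_in) auto
    then obtain a0 where a0: "a0 \<in> P" "0 < f a0" "m = f a0" by auto
    have m_le: "m \<le> f a" if "a \<in> ?F" for a
      unfolding m_def using that by (intro Min_le) auto
    define f' where "f' a = (if a \<in> ?F then f a - m else 0)" for a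
    have "poset_filter P r ?F"
      unfolding poset_filter_def using less.prems(4) by fastforce
    with h have hF: "0 \<le> (\<Sum>a\<in>?F. h $ a)" "(\<Sum>a\<in>?F. h $ a) \<le> 1"
      unfolding Val0_def by blast+
    have "{a \<in> P. 0 < f' a} \<subset> ?F"
      using a0 by (auto simp: f'_def split: if_splits)
    then have "card {a \<in> P. 0 < f' a} < card ?F"
      by (intro psubset_card_mono) auto
    then have IH: "0 \<le> (\<Sum>a\<in>P. h $ a * f' a) \<and> (\<Sum>a\<in>P. h $ a * f' a) \<le> c - m"
    proof (rule less.hyps)
      show "0 \<le> f' a" for a
        using m_le by (auto simp: f'_def)
      show "0 \<le> c - m"
        using less.prems(2)[OF a0(1)] a0 by simp
      then show "f' a \<le> c - m" if "a \<in> P" for a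
        using less.prems(2)[OF that] by (auto simp: f'_def)
      show "f' a \<le> f' b" if "a \<in> P" "b \<in> P" "(a, b) \<in> r" for a b
        using less.prems(4)[OF that] m_le that by (auto simp: f'_def)
    qed
    have "(\<Sum>a\<in>P. h $ a * f a) = (\<Sum>a\<in>P. h $ a * f' a + (if a \<in> ?F then m * h $ a else 0))"
      using less.prems(1) by (intro sum.cong) (force simp: f'_def algebra_simps)+
    also have "\<dots> = (\<Sum>a\<in>P. h $ a * f' a) + m * (\<Sum>a\<in>?F. h $ a)"
      by (simp add: sum.distrib sum.If_cases sum_distrib_left Int_def conj_commute)
    finally have eq: "(\<Sum>a\<in>P. h $ a * f a) = (\<Sum>a\<in>P. h $ a * f' a) + m * (\<Sum>a\<in>?F. h $ a)" .
    have "0 \<le> m * (\<Sum>a\<in>?F. h $ a)" "m * (\<Sum>a\<in>?F. h $ a) \<le> m"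
      using a0 hF by (auto intro: mult_left_le)
    with IH eq show ?thesis by linarith
  qed
qed

lemma Val0_inner_order_polytope:
  assumes r: "partial_order_on P r" and h: "h \<in> Val0 P r" and f: "f \<in> order_polytope P r"
  shows "0 \<le> h \<bullet> f" and "h \<bullet> f \<le> 1"
proof -
  \<comment> \<open>The bounds 0 and 1 in \<open>order_polytope\<close> are imposed only on related
    pairs; the pair \<open>(a, a)\<close> gives them at each point.\<close>
  have rf: "(a, a) \<in> r" if "a \<in> P" for a
    using r that by (auto simp: partial_order_on_def preorder_on_def refl_on_def)
  have "0 \<le> (\<Sum>a\<in>P. h $ a * f $ a) \<and> (\<Sum>a\<in>P. h $ a * f $ a) \<le> 1"
    using f rf by (intro monotone_pairing_bounds[OF h]) (auto simp: order_polytope_def)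
  moreover have "h \<in> funs_on P" using h by (simp add: Val0_def)
  ultimately show "0 \<le> h \<bullet> f" "h \<bullet> f \<le> 1"
    by (simp_all add: inner_vec_eq_sum_on)
qed

section \<open>Compactness of the valuation polytope\<close>

lemma zero_in_Val0: "0 \<in> Val0 P r"
  by (simp add: Val0_def funs_on_def)

text \<open>By antisymmetry and transitivity the principal filter of \<open>a\<close> stays a filter
  when \<open>a\<close> is removed, so \<open>h $ a\<close> is a difference of two filter sums in
  [0,1].\<close>

lemma Val0_component_bound:
  assumes r: "partial_order_on P r" and h: "h \<in> Val0 P r"
  shows "\<bar>h $ a\<bar> \<le> 1"
proof (cases "a \<in> P")
  case False
  then show ?thesis using h by (simp add: Val0_def funs_on_def)
next
  case True
  have rf: "(a, a) \<in> r" and tr: "trans r" and as: "antisym r"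
    using r True by (auto simp: partial_order_on_def preorder_on_def refl_on_def)
  let ?U = "{b \<in> P. (a, b) \<in> r}"
  have "poset_filter P r ?U" "poset_filter P r (?U - {a})"
    unfolding poset_filter_def using tr as by (auto dest: transD antisymD)
  then have "0 \<le> sum (($) h) ?U" "sum (($) h) ?U \<le> 1"
    "0 \<le> sum (($) h) (?U - {a})" "sum (($) h) (?U - {a}) \<le> 1"
    using h unfolding Val0_def by blast+
  moreover have "sum (($) h) ?U = h $ a + sum (($) h) (?U - {a})"
    using True rf by (intro sum.remove) auto
  ultimately show ?thesis by linarith
qed

lemma compact_Val0:
  assumes "partial_order_on P r"
  shows "compact (Val0 P r)"
proof -
  have "norm h \<le> (\<Sum>a\<in>(UNIV::'a set). 1)" if "h \<in> Val0 P r" for h :: "real ^ 'a"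
    using Val0_component_bound[OF assms that]
    by (intro order_trans[OF norm_le_l1_cart] sum_mono) auto
  then have "bounded (Val0 P r)"
    unfolding bounded_iff by blast
  moreover have "closed (Val0 P r)"
    unfolding Val0_def funs_on_def mem_Collect_eq
    by (intro closed_Collect_conj closed_Collect_all closed_Collect_imp closed_Collect_eq
          closed_Collect_le open_Collect_const continuous_intros)
  ultimately show ?thesis
    by (simp add: compact_eq_bounded_closed)
qed

section \<open>Splitting a vector into a difference of monotone functions\<close>

definition Val0_below :: "'a::finite set \<Rightarrow> 'a rel \<Rightarrow> 'a \<Rightarrow> (real ^ 'a) set"
  where "Val0_below P r a = {h \<in> Val0 P r. \<forall>b. (b, a) \<notin> r \<longrightarrow> h $ b = 0}"

text \<open>On a filter containing \<open>a\<close> the sum of \<open>h\<close> turns into 1 minus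
  itself. A filter missing \<open>a\<close> contains nothing below \<open>a\<close>, so both sums
  vanish there.\<close>

lemma axis_minus_in_Val0_below:
  assumes r: "partial_order_on P r" and a: "a \<in> P" and h: "h \<in> Val0_below P r a"
  shows "axis a 1 - h \<in> Val0_below P r a"
proof -
  have rf: "(a, a) \<in> r"
    using r a by (auto simp: partial_order_on_def preorder_on_def refl_on_def)
  have hV: "h \<in> Val0 P r" and hb: "\<And>b. (b, a) \<notin> r \<Longrightarrow> h $ b = 0"
    using h by (auto simp: Val0_below_def)
  have "0 \<le> (\<Sum>b\<in>\<Phi>. (axis a 1 - h) $ b) \<and> (\<Sum>b\<in>\<Phi>. (axis a 1 - h) $ b) \<le> 1"
    if \<Phi>: "poset_filter P r \<Phi>" for \<Phi>
  proof -
    have eq: "(\<Sum>b\<in>\<Phi>. (axis a 1 - h) $ b) = (if a \<in> \<Phi> then 1 else 0) - (\<Sum>b\<in>\<Phi>. h $ b)"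
      by (simp add: sum_subtractf axis_def)
    show ?thesis
    proof (cases "a \<in> \<Phi>")
      case True
      have "0 \<le> (\<Sum>b\<in>\<Phi>. h $ b) \<and> (\<Sum>b\<in>\<Phi>. h $ b) \<le> 1"
        using hV \<Phi> by (simp add: Val0_def)
      with True eq show ?thesis by simp
    next
      case False
      then have "h $ b = 0" if "b \<in> \<Phi>" for b
        using that \<Phi> a hb by (auto simp: poset_filter_def)
      with False eq show ?thesis by simp
    qed
  qed
  moreover have "axis a 1 - h \<in> funs_on P"
    using hV a by (auto simp: Val0_def funs_on_def axis_def)
  ultimately show ?thesis
    using hb rf by (auto simp: Val0_below_def Val0_def axis_def)
qed

text \<open>This is the \<open>f\<close> of the overview; the \<open>g\<close> there is its value at
  \<open>- x\<close>.\<close>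

definition lower_support :: "'a::finite set \<Rightarrow> 'a rel \<Rightarrow> real ^ 'a \<Rightarrow> real ^ 'a"
  where "lower_support P r x =
    (\<chi> a. if a \<in> P then (SUP h\<in>Val0_below P r a. x \<bullet> h) else 0)"

lemma bdd_above_inner_Val0:
  assumes "partial_order_on P r"
  shows "bdd_above ((\<bullet>) x ` Val0 P r)"
  by (intro bounded_imp_bdd_above compact_imp_bounded compact_continuous_image
      continuous_intros compact_Val0 assms)

text \<open>Everything comes from inclusions of index sets: each \<open>Val0_below P r a\<close>
  contains 0, lies in \<open>Val0 P r\<close>, and grows with \<open>a\<close> by transitivity.
  Compactness makes the suprema finite.\<close>

lemma lower_support_bounds:
  assumes r: "partial_order_on P r"
  shows "lower_support P r x \<in> funs_on P"
    and "a \<in> P \<Longrightarrow> 0 \<le> lower_support P r x $ a"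
    and "a \<in> P \<Longrightarrow> lower_support P r x $ a \<le> (SUP h\<in>Val0 P r. x \<bullet> h)"
    and "a \<in> P \<Longrightarrow> b \<in> P \<Longrightarrow> (a, b) \<in> r \<Longrightarrow> lower_support P r x $ a \<le> lower_support P r x $ b"
proof -
  have zero: "0 \<in> Val0_below P r a" for a
    by (simp add: Val0_below_def zero_in_Val0)
  have sub: "Val0_below P r a \<subseteq> Val0 P r" for a
    by (auto simp: Val0_below_def)
  have bdd: "bdd_above ((\<bullet>) x ` Val0_below P r a)" for a
    by (rule bdd_above_mono[OF bdd_above_inner_Val0[OF r]]) (use sub in blast)
  show "lower_support P r x \<in> funs_on P"
    by (simp add: lower_support_def funs_on_def)
  show "0 \<le> lower_support P r x $ a" if "a \<in> P"
    using cSUP_upper[OF zero bdd] that by (simp add: lower_support_def)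
  show "lower_support P r x $ a \<le> (SUP h\<in>Val0 P r. x \<bullet> h)" if "a \<in> P"
    using that zero sub
    by (auto simp: lower_support_def intro!: cSUP_subset_mono bdd_above_inner_Val0[OF r])
  show "lower_support P r x $ a \<le> lower_support P r x $ b" if "a \<in> P" "b \<in> P" "(a, b) \<in> r"
  proof -
    have "trans r" using r by (auto simp: partial_order_on_def preorder_on_def)
    then have "Val0_below P r a \<subseteq> Val0_below P r b"
      using that unfolding Val0_below_def by (blast dest: transD)
    then show ?thesis
      using that zero bdd by (auto simp: lower_support_def intro!: cSUP_subset_mono)
  qed
qed

text \<open>The reflection rewrites \<open>x \<bullet> h\<close> as \<open>x $ a\<close> plus the
  value of \<open>- x\<close> at \<open>axis a 1 - h\<close>, which is again an admissible point of
  the supremum for \<open>- x\<close>.\<close>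

lemma lower_support_le_add:
  assumes r: "partial_order_on P r" and a: "a \<in> P"
  shows "lower_support P r x $ a \<le> x $ a + lower_support P r (- x) $ a"
proof -
  have "x \<bullet> h \<le> x $ a + (SUP h\<in>Val0_below P r a. (- x) \<bullet> h)" if h: "h \<in> Val0_below P r a" for h
  proof -
    have "bdd_above ((\<bullet>) (- x) ` Val0_below P r a)"
      by (rule bdd_above_mono[OF bdd_above_inner_Val0[OF r]], rule image_mono)
        (auto simp: Val0_below_def)
    then have "(- x) \<bullet> (axis a 1 - h) \<le> (SUP h\<in>Val0_below P r a. (- x) \<bullet> h)"
      by (intro cSUP_upper axis_minus_in_Val0_below[OF r a h])
    then show ?thesis by (simp add: inner_diff_right inner_axis)
  qed
  moreover have "Val0_below P r a \<noteq> {}"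
    using zero_in_Val0[of P r] by (auto simp: Val0_below_def)
  ultimately show ?thesis
    using a by (simp add: lower_support_def cSUP_least)
qed

lemma lower_support_decomposition:
  assumes "partial_order_on P r" and "a \<in> P"
  shows "x $ a = lower_support P r x $ a - lower_support P r (- x) $ a"
  using lower_support_le_add[OF assms, of x] lower_support_le_add[OF assms, of "- x"] by simp

section \<open>Inequalities describing the polar\<close>

lemma polar_in_convex_hull: "polar_in V (convex hull S) = polar_in V S"
proof -
  have "l \<bullet> s \<le> 1" if "\<forall>s\<in>S. l \<bullet> s \<le> 1" "s \<in> convex hull S" for l s
  proof -
    have "convex hull S \<subseteq> {s. l \<bullet> s \<le> 1}"
      using that(1) by (intro hull_minimal convex_halfspace_le) auto
    then show ?thesis using that(2) by blast
  qed
  then show ?thesis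
    by (auto simp: polar_in_def hull_inc)
qed

text \<open>Only the generators need testing; the copies at heights 1 and -1 give the upper and the
  lower half of the absolute value bound.\<close>

lemma polar_double_order_polytope_iff:
  "(l, t) \<in> polar_in (funs_on P \<times> UNIV) (double_order_polytope P r r) \<longleftrightarrow>
    l \<in> funs_on P \<and> (\<forall>f\<in>order_polytope P r. \<bar>2 * (l \<bullet> f) + t\<bar> \<le> 1)"
  unfolding double_order_polytope_def polar_in_convex_hull
  by (force simp: polar_in_def ball_Un abs_le_iff)

text \<open>Homogeneous form of the previous criterion, obtained by testing on \<open>f\<close>
  divided by \<open>c\<close>; for \<open>c = 0\<close> the function \<open>f\<close> itself
  vanishes.\<close>

lemma polar_double_order_polytope_scaled:
  assumes lt: "(l, t) \<in> polar_in (funs_on P \<times> UNIV) (double_order_polytope P r r)"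
    and f: "f \<in> funs_on P" "\<And>a. a \<in> P \<Longrightarrow> 0 \<le> f $ a" "\<And>a. a \<in> P \<Longrightarrow> f $ a \<le> c" "0 \<le> c"
      "\<And>a b. a \<in> P \<Longrightarrow> b \<in> P \<Longrightarrow> (a, b) \<in> r \<Longrightarrow> f $ a \<le> f $ b"
  shows "\<bar>2 * (l \<bullet> f) + c * t\<bar> \<le> c"
proof (cases "c = 0")
  case True
  have "f $ a = 0" for a
    using f(1) f(2,3)[of a] True by (cases "a \<in> P") (auto simp: funs_on_def)
  then have "f = 0" by (simp add: vec_eq_iff)
  with True show ?thesis by simp
next
  case False
  with f have c: "0 < c" by simp
  have "(1 / c) *\<^sub>R f \<in> order_polytope P r"
    using f c by (auto simp: order_polytope_def funs_on_def divide_right_mono)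
  then have "\<bar>2 * (l \<bullet> ((1 / c) *\<^sub>R f)) + t\<bar> \<le> 1"
    using lt by (simp only: polar_double_order_polytope_iff)
  then have "c * \<bar>2 * (l \<bullet> f) / c + t\<bar> \<le> c"
    using c by simp
  also have "c * \<bar>2 * (l \<bullet> f) / c + t\<bar> = \<bar>c * (2 * (l \<bullet> f) / c + t)\<bar>"
    using c by (simp add: abs_mult)
  also have "c * (2 * (l \<bullet> f) / c + t) = 2 * (l \<bullet> f) + c * t"
    using c by (simp add: field_simps)
  finally show ?thesis .
qed

text \<open>With \<open>M\<close> and \<open>N\<close> the two suprema and \<open>x = f - g\<close>
  on \<open>P\<close>, the scaled bounds give \<open>2 * (l \<bullet> f) \<le> (1 - t) * M\<close>
  and \<open>- 2 * (l \<bullet> g) \<le> (1 + t) * N\<close>. Their sum is the claim.\<close>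

lemma polar_inner_le_support:
  assumes r: "partial_order_on P r"
    and lt: "(l, t) \<in> polar_in (funs_on P \<times> UNIV) (double_order_polytope P r r)"
  shows "2 * (l \<bullet> x) \<le> (1 - t) * (SUP h\<in>Val0 P r. x \<bullet> h) + (1 + t) * (SUP h\<in>Val0 P r. (- x) \<bullet> h)"
proof -
  have nonneg: "0 \<le> (SUP h\<in>Val0 P r. y \<bullet> h)" for y
    using cSUP_upper[OF zero_in_Val0 bdd_above_inner_Val0[OF r, of y]] by simp
  have bound: "\<bar>2 * (l \<bullet> lower_support P r y) + (SUP h\<in>Val0 P r. y \<bullet> h) * t\<bar>
      \<le> (SUP h\<in>Val0 P r. y \<bullet> h)" for y
    by (intro polar_double_order_polytope_scaled[OF lt] lower_support_bounds[OF r] nonneg)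
  have l: "l \<in> funs_on P"
    using lt by (simp add: polar_double_order_polytope_iff)
  have "l \<bullet> x = l \<bullet> (lower_support P r x - lower_support P r (- x))"
    unfolding inner_vec_eq_sum_on[OF l] using lower_support_decomposition[OF r, of _ x]
    by (intro sum.cong) auto
  then have "2 * (l \<bullet> x) = 2 * (l \<bullet> lower_support P r x) - 2 * (l \<bullet> lower_support P r (- x))"
    by (simp add: inner_diff_right)
  then show ?thesis
    using bound[of x] bound[of "- x"] by (simp only: abs_le_iff) (simp add: algebra_simps)
qed

section \<open>The two inclusions\<close>

theorem theorem2p22:
  fixes P :: "'a::finite set" and r :: "'a rel"
  assumes "partial_order_on P r"
  shows "polar_in (funs_on P \<times> UNIV) (double_order_polytope P r r) =
    convex hull (uminus ` Val0 P r \<times> {1} \<union> Val0 P r \<times> {- 1})"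
    (is "?L = convex hull ?S")
proof
  have "?S \<subseteq> ?L"
  proof
    fix z assume "z \<in> ?S"
    then obtain h where h: "h \<in> Val0 P r" and z: "z = (- h, 1) \<or> z = (h, - 1)"
      by auto
    have "h \<in> funs_on P" "- h \<in> funs_on P"
      using h by (auto simp: Val0_def funs_on_def)
    \<comment> \<open>Since \<open>h \<bullet> f\<close> lies in [0,1], both
      \<open>1 - 2 * (h \<bullet> f)\<close> and its negative lie in [-1,1].\<close>
    with z show "z \<in> ?L"
      using Val0_inner_order_polytope[OF assms h]
      by (auto simp: polar_double_order_polytope_iff abs_le_iff)
  qed
  moreover have "convex ?L"
    unfolding convex_def
  proof (intro ballI allI impI)
    fix y z :: "(real ^ 'a) \<times> real" and u v :: real
    assume yz: "y \<in> ?L" "z \<in> ?L" and uv: "0 \<le> u" "0 \<le> v" "u + v = 1"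
    have "(u *\<^sub>R y + v *\<^sub>R z) \<bullet> s \<le> 1" if "s \<in> double_order_polytope P r r" for s
    proof -
      have "y \<bullet> s \<le> 1" "z \<bullet> s \<le> 1" using yz that by (auto simp: polar_in_def)
      then have "u * (y \<bullet> s) + v * (z \<bullet> s) \<le> 1"
        using uv by (intro convex_bound_le)
      then show ?thesis by (simp add: inner_add_left)
    qed
    moreover have "u *\<^sub>R y + v *\<^sub>R z \<in> funs_on P \<times> UNIV"
      using yz by (auto simp: polar_in_def funs_on_def)
    ultimately show "u *\<^sub>R y + v *\<^sub>R z \<in> ?L"
      by (simp add: polar_in_def)
  qed
  ultimately show "convex hull ?S \<subseteq> ?L"
    by (rule hull_minimal)
next
  show "?L \<subseteq> convex hull ?S"
  proof (rule subsetI, rule ccontr)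
    fix z assume zL: "z \<in> ?L" and zS: "z \<notin> convex hull ?S"
    obtain l t where z: "z = (l, t)" by fastforce
    have "compact (uminus ` Val0 P r)"
      by (intro compact_continuous_image compact_Val0 assms continuous_intros)
    then have "compact ?S"
      by (intro compact_Un compact_Times compact_Val0 assms) auto
    then have "closed (convex hull ?S)"
      by (intro compact_imp_closed compact_convex_hull)
    then obtain w c where w: "w \<bullet> z < c" "\<forall>y\<in>convex hull ?S. c < w \<bullet> y"
      using separating_hyperplane_closed_point[OF convex_convex_hull _ zS] by auto
    \<comment> \<open>The sign is flipped so that \<open>(x, s)\<close> exceeds \<open>- c\<close>
      at \<open>z\<close> and stays below it on the hull, as suits suprema.\<close>
    obtain x s where x: "- w = (x, s)" by fastforce
    then have wx: "w = (- x, - s)" by (metis minus_minus uminus_Pair)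
    have sep: "- c < x \<bullet> l + s * t"
      using w(1) by (simp add: wx z)
    have gen: "(- x, - s) \<bullet> y > c" if "y \<in> ?S" for y
      using w(2) that by (auto simp: wx hull_inc)
    have "x \<bullet> h \<le> s - c" "(- x) \<bullet> h \<le> - s - c" if "h \<in> Val0 P r" for h
      using gen[of "(h, - 1)"] gen[of "(- h, 1)"] that by auto
    then have le: "(SUP h\<in>Val0 P r. x \<bullet> h) \<le> s - c" "(SUP h\<in>Val0 P r. (- x) \<bullet> h) \<le> - s - c"
      using zero_in_Val0[of P r] by (auto intro!: cSUP_least)
    \<comment> \<open>Testing on the zero function bounds \<open>t\<close>, which makes the weights
      \<open>1 - t\<close> and \<open>1 + t\<close> nonnegative.\<close>
    have "0 \<in> order_polytope P r"
      by (simp add: order_polytope_def funs_on_def)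
    then have t: "\<bar>t\<bar> \<le> 1"
      using zL by (force simp: z polar_double_order_polytope_iff)
    have "2 * (l \<bullet> x) \<le>
        (1 - t) * (SUP h\<in>Val0 P r. x \<bullet> h) + (1 + t) * (SUP h\<in>Val0 P r. (- x) \<bullet> h)"
      using polar_inner_le_support[OF assms] zL by (simp only: z)
    also have "\<dots> \<le> (1 - t) * (s - c) + (1 + t) * (- s - c)"
      using t by (intro add_mono mult_left_mono le) auto
    \<comment> \<open>The terms in \<open>c * t\<close> cancel, leaving exactly twice the bound that
      \<open>sep\<close> says is exceeded.\<close>
    also have "\<dots> = - 2 * (s * t) - 2 * c"
      by (simp add: algebra_simps)
    finally show False
      using sep by (simp add: inner_commute)
  qed
qed

end
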